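(* Let $\xi : I\to Q$ be a regular unit speed real quaternionic curve. If any real quaternionic curve $\phi : I\to Q$ is a quaternionic involute of the curve $\xi$, then $d(\xi(s),\phi(s^* ))=|c-s|$, where $c$ is a real number.
   Context: $Q$ is the algebra of real quaternions, identified with Euclidean space $\mathbb{R}^4$, and $I\subset\mathbb{R}$ is an interval. $\times$ is the quaternion product, $\hat q=S_q-V_q$ is the conjugate of the quaternion $q=S_q+V_q$ with scalar part $S_q$ and vector part $V_q$, $h(p,q)=\frac12(p\times\hat q+q\times\hat p)$ is the quaternion inner product, and $d$ is the Euclidean distance. A real quaternionic curve is a smooth curve $I\to Q$. The curve $\xi$ has parameter $s$ (arc length, since $\xi$ has unit speed) and $\phi$ has parameter $s^*$; $s$ and $s^*$ denote parameters of corresponding points of the two curves. $T_\xi$ and $T_\phi$ denote the unit tangent vectors, i.e. the first vectors of the Serret-Frenet frames $\{T_\xi,N_\xi,B_\xi,E_\xi\}$ and $\{T_\phi,N_\phi,B_\phi,E_\phi\}$ of $\xi$ and $\phi$. Definition: regular real quaternionic curves $\phi,\xi : I\to Q$ with parameters $s^*$ and $s$, respectively, are called real quaternionic involute-evolute curves $\{\phi,\xi\}$ in $Q$ ($\phi$ being a quaternionic involute of $\xi$, and $\xi$ an evolute of $\phi$) if $h(T_\phi(s^* ),T_\xi(s))=0$.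
   Formalization: The formal theorem also assumes that the tangent line of ξ at ξ(s) passes through the corresponding point φ(s* ), with s* a differentiable function of s; orthogonal tangents alone do not suffice: ξ(s)=s e₁, φ(s)=s e₂, s*=s gives d=√2|s|. *)

theory Defs
  imports "HOL-Analysis.Analysis"
begin

text \<open>
  The quaternions are carried by \<open>real ^ 4\<close>, which supplies the Euclidean norm and distance;
  coordinate 1 is the scalar part, coordinates 2, 3, 4 are the coefficients of i, j, k.
  The class instance \<open>*\<close> on \<open>real ^ 4\<close> is the componentwise product, not the quaternion product.
\<close>

type_synonym quat = "real ^ 4"

definition Quat :: "real \<Rightarrow> real \<Rightarrow> real \<Rightarrow> real \<Rightarrow> quat" where
  "Quat a b c d = vector [a, b, c, d]"

lemma Quat_nth [simp]:
  "Quat a b c d $ 1 = a" "Quat a b c d $ 2 = b" "Quat a b c d $ 3 = c" "Quat a b c d $ 4 = d"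
  by (simp_all add: Quat_def vector_def)

lemma quat_eq_iff:
  fixes p q :: quat
  shows "p = q \<longleftrightarrow> p $ 1 = q $ 1 \<and> p $ 2 = q $ 2 \<and> p $ 3 = q $ 3 \<and> p $ 4 = q $ 4"
  by (simp add: vec_eq_iff forall_4)

definition quat_times :: "quat \<Rightarrow> quat \<Rightarrow> quat" (infixl "\<otimes>\<^sub>Q" 70) where
  "p \<otimes>\<^sub>Q q = Quat
     (p $ 1 * q $ 1 - p $ 2 * q $ 2 - p $ 3 * q $ 3 - p $ 4 * q $ 4)
     (p $ 1 * q $ 2 + p $ 2 * q $ 1 + p $ 3 * q $ 4 - p $ 4 * q $ 3)
     (p $ 1 * q $ 3 - p $ 2 * q $ 4 + p $ 3 * q $ 1 + p $ 4 * q $ 2)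
     (p $ 1 * q $ 4 + p $ 2 * q $ 3 - p $ 3 * q $ 2 + p $ 4 * q $ 1)"

definition scalar_part :: "quat \<Rightarrow> quat" where
  "scalar_part q = Quat (q $ 1) 0 0 0"

definition vector_part :: "quat \<Rightarrow> quat" where
  "vector_part q = Quat 0 (q $ 2) (q $ 3) (q $ 4)"

definition quat_conj :: "quat \<Rightarrow> quat" where
  "quat_conj q = scalar_part q - vector_part q"

text \<open>The quaternion inner product is a quaternion whose vector part vanishes.\<close>

definition quat_inner :: "quat \<Rightarrow> quat \<Rightarrow> quat" where
  "quat_inner p q = (1 / 2) *\<^sub>R (p \<otimes>\<^sub>Q quat_conj q + q \<otimes>\<^sub>Q quat_conj p)"

lemma quat_inner_eq: "quat_inner p q = Quat (p \<bullet> q) 0 0 0"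
  by (simp add: quat_eq_iff quat_inner_def quat_times_def quat_conj_def scalar_part_def
      vector_part_def inner_vec_def sum_4 algebra_simps)

text \<open>
  Derivatives along a curve on \<open>I\<close> are taken within \<open>I\<close>, hence one-sided at an end point
  belonging to \<open>I\<close>. Smooth means infinitely differentiable.
\<close>

definition curve_deriv :: "real set \<Rightarrow> (real \<Rightarrow> quat) \<Rightarrow> real \<Rightarrow> quat" where
  "curve_deriv I \<gamma> t = vector_derivative \<gamma> (at t within I)"

definition quat_curve :: "real set \<Rightarrow> (real \<Rightarrow> quat) \<Rightarrow> bool" where
  "quat_curve I \<gamma> \<longleftrightarrow> (\<forall>n. (curve_deriv I ^^ n) \<gamma> differentiable_on I)"

definition regular_curve :: "real set \<Rightarrow> (real \<Rightarrow> quat) \<Rightarrow> bool" where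
  "regular_curve I \<gamma> \<longleftrightarrow> quat_curve I \<gamma> \<and> (\<forall>t\<in>I. curve_deriv I \<gamma> t \<noteq> 0)"

definition unit_speed :: "real set \<Rightarrow> (real \<Rightarrow> quat) \<Rightarrow> bool" where
  "unit_speed I \<gamma> \<longleftrightarrow> (\<forall>t\<in>I. norm (curve_deriv I \<gamma> t) = 1)"

definition unit_tangent :: "real set \<Rightarrow> (real \<Rightarrow> quat) \<Rightarrow> real \<Rightarrow> quat" where
  "unit_tangent I \<gamma> t = curve_deriv I \<gamma> t /\<^sub>R norm (curve_deriv I \<gamma> t)"

text \<open>
  The function \<open>\<sigma>\<close> gives the parameter \<open>s\<^sup>* = \<sigma> s\<close> of the point of \<open>\<phi>\<close> that corresponds to
  \<open>\<xi> s\<close>. As usual for involutes, corresponding points are related by the tangent lines of the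
  evolute: the tangent line of \<open>\<xi>\<close> at \<open>\<xi> s\<close> passes through \<open>\<phi> (\<sigma> s)\<close>. Orthogonality of the
  tangents alone does not tie the positions of the two curves together: it is unaffected by
  translating \<open>\<phi>\<close>.
\<close>

definition corresponding_points ::
  "real set \<Rightarrow> (real \<Rightarrow> real) \<Rightarrow> (real \<Rightarrow> quat) \<Rightarrow> (real \<Rightarrow> quat) \<Rightarrow> bool" where
  "corresponding_points I \<sigma> \<phi> \<xi> \<longleftrightarrow>
     \<sigma> differentiable_on I \<and> \<sigma> ` I \<subseteq> I \<and>
     (\<forall>s\<in>I. \<exists>r. \<phi> (\<sigma> s) = \<xi> s + r *\<^sub>R unit_tangent I \<xi> s)"

definition involute_evolute ::
  "real set \<Rightarrow> (real \<Rightarrow> real) \<Rightarrow> (real \<Rightarrow> quat) \<Rightarrow> (real \<Rightarrow> quat) \<Rightarrow> bool" where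
  "involute_evolute I \<sigma> \<phi> \<xi> \<longleftrightarrow>
     regular_curve I \<phi> \<and> regular_curve I \<xi> \<and>
     (\<forall>s\<in>I. quat_inner (unit_tangent I \<phi> (\<sigma> s)) (unit_tangent I \<xi> s) = 0)"

end

theory Submission
  imports Defs
begin

text \<open>
  Write \<open>\<phi> (\<sigma> s) - \<xi> s = r s *\<^sub>R T s\<close> with \<open>T\<close> the unit tangent of \<open>\<xi>\<close>, so that
  \<open>r = (\<phi> \<circ> \<sigma> - \<xi>) \<bullet> T\<close>. Since the derivatives of both \<open>\<phi> \<circ> \<sigma>\<close> and \<open>T\<close> are orthogonal to
  \<open>T\<close>, and \<open>\<xi>\<close> has derivative \<open>T\<close>, the derivative of \<open>r\<close> is \<open>-1\<close>. Hence \<open>r s + s\<close> is constant.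
\<close>

text \<open>Differentiate the constant function \<open>f x \<bullet> f x\<close>. The filter must be
  nontrivial because at an isolated point of \<open>S\<close> every vector is a derivative, so the
  two derivatives found need not agree.\<close>

lemma orthogonal_vector_derivative_of_const_norm:
  fixes f :: "real \<Rightarrow> 'a::real_inner"
  assumes f: "(f has_vector_derivative f') (at t within S)"
    and const: "\<And>x. x \<in> S \<Longrightarrow> norm (f x) = k"
    and t: "t \<in> S" "at t within S \<noteq> bot"
  shows "f t \<bullet> f' = 0"
proof -
  have "((\<lambda>x. f x \<bullet> f x) has_vector_derivative f t \<bullet> f' + f' \<bullet> f t) (at t within S)"
    by (rule bounded_bilinear.has_vector_derivative[OF bounded_bilinear_inner f f])
  moreover have "((\<lambda>x. f x \<bullet> f x) has_vector_derivative 0) (at t within S)"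
    by (rule has_vector_derivative_transform[of t S _ "\<lambda>_. k\<^sup>2"])
      (simp_all add: t const flip: power2_norm_eq_inner)
  ultimately have "f t \<bullet> f' + f' \<bullet> f t = 0"
    using t(2) vector_derivative_unique_within by blast
  then show ?thesis
    by (simp add: inner_commute)
qed

lemma quat_curve_has_vector_derivative:
  assumes "quat_curve I \<gamma>" "t \<in> I"
  shows "(\<gamma> has_vector_derivative curve_deriv I \<gamma> t) (at t within I)"
proof -
  have "(curve_deriv I ^^ 0) \<gamma> differentiable_on I"
    using assms(1) unfolding quat_curve_def by blast
  then show ?thesis
    using assms(2) by (simp add: differentiable_on_def curve_deriv_def vector_derivative_works)
qed

lemma quat_curve_curve_deriv:
  assumes "quat_curve I \<gamma>"
  shows "quat_curve I (curve_deriv I \<gamma>)"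
  unfolding quat_curve_def
proof
  fix n
  have "(curve_deriv I ^^ Suc n) \<gamma> differentiable_on I"
    using assms unfolding quat_curve_def by blast
  then show "(curve_deriv I ^^ n) (curve_deriv I \<gamma>) differentiable_on I"
    by (simp add: funpow_swap1)
qed

lemma quat_inner_eq_0_iff: "quat_inner p q = 0 \<longleftrightarrow> p \<bullet> q = 0"
  by (simp add: quat_inner_eq quat_eq_iff)

text \<open>Product rule at a single point: the term with the derivative of the tangent vanishes
  because the displacement is tangential, and the other term reduces to minus the squared norm of
  the unit tangent.\<close>

lemma has_vector_derivative_tangential_displacement:
  fixes \<xi> \<phi> :: "real \<Rightarrow> quat"
  assumes nontriv: "s \<in> I" "at s within I \<noteq> bot"
    and \<xi>: "quat_curve I \<xi>" "unit_speed I \<xi>"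
    and \<phi>: "quat_curve I \<phi>"
    and \<sigma>: "\<sigma> differentiable_on I" "\<sigma> ` I \<subseteq> I"
    and tangent: "\<phi> (\<sigma> s) = \<xi> s + r *\<^sub>R curve_deriv I \<xi> s"
    and orth: "curve_deriv I \<phi> (\<sigma> s) \<bullet> curve_deriv I \<xi> s = 0"
  shows "((\<lambda>x. (\<phi> (\<sigma> x) - \<xi> x) \<bullet> curve_deriv I \<xi> x) has_vector_derivative -1) (at s within I)"
proof -
  define T where "T = curve_deriv I \<xi>"
  obtain T' where T': "(T has_vector_derivative T') (at s within I)"
    using quat_curve_has_vector_derivative[OF quat_curve_curve_deriv[OF \<xi>(1)] nontriv(1)]
    unfolding T_def by blast
  have norm_T: "norm (T x) = 1" if "x \<in> I" for x
    using \<xi>(2) that by (simp add: unit_speed_def T_def)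
  have T_T': "T s \<bullet> T' = 0"
    using orthogonal_vector_derivative_of_const_norm[OF T' norm_T nontriv] .
  obtain \<sigma>' where \<sigma>': "(\<sigma> has_vector_derivative \<sigma>') (at s within I)"
    using \<sigma>(1) nontriv(1) by (auto simp: differentiable_on_def vector_derivative_works)
  \<comment> \<open>The chain rule asks for a derivative within the image of
    \<open>\<sigma>\<close>, so the one within \<open>I\<close> is restricted.\<close>
  have "(\<phi> has_vector_derivative curve_deriv I \<phi> (\<sigma> s)) (at (\<sigma> s) within \<sigma> ` I)"
    using has_vector_derivative_within_subset[OF quat_curve_has_vector_derivative[OF \<phi>]] \<sigma>(2)
      nontriv(1) by blast
  from vector_diff_chain_within[OF \<sigma>' this]
  have "((\<lambda>x. \<phi> (\<sigma> x)) has_vector_derivative \<sigma>' *\<^sub>R curve_deriv I \<phi> (\<sigma> s)) (at s within I)"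
    by (simp add: comp_def)
  then have "((\<lambda>x. \<phi> (\<sigma> x) - \<xi> x) has_vector_derivative
      \<sigma>' *\<^sub>R curve_deriv I \<phi> (\<sigma> s) - T s) (at s within I)"
    using quat_curve_has_vector_derivative[OF \<xi>(1) nontriv(1)]
    unfolding T_def by (rule has_vector_derivative_diff)
  from bounded_bilinear.has_vector_derivative[OF bounded_bilinear_inner this T']
  have "((\<lambda>x. (\<phi> (\<sigma> x) - \<xi> x) \<bullet> T x) has_vector_derivative
      (\<phi> (\<sigma> s) - \<xi> s) \<bullet> T' + (\<sigma>' *\<^sub>R curve_deriv I \<phi> (\<sigma> s) - T s) \<bullet> T s) (at s within I)" .
  moreover have "T s \<bullet> T s = 1"
    using norm_T[OF nontriv(1)] by (simp add: norm_eq_1)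
  moreover have "(\<phi> (\<sigma> s) - \<xi> s) \<bullet> T' = 0"
    using tangent T_T' by (simp add: T_def)
  ultimately show ?thesis
    using orth by (simp add: T_def inner_diff_left)
qed

theorem theorem3p3:
  fixes I :: "real set" and \<xi> \<phi> :: "real \<Rightarrow> quat" and \<sigma> :: "real \<Rightarrow> real"
  assumes "is_interval I"
    and "regular_curve I \<xi>" and "unit_speed I \<xi>"
    and "quat_curve I \<phi>"
    and "corresponding_points I \<sigma> \<phi> \<xi>"
    and "involute_evolute I \<sigma> \<phi> \<xi>"
  shows "\<exists>c::real. \<forall>s\<in>I. dist (\<xi> s) (\<phi> (\<sigma> s)) = \<bar>c - s\<bar>"
\<comment> \<open>On an interval with at most one point derivatives carry no information, but a
  single distance can be matched by the choice of the constant.\<close>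
proof (cases "\<exists>a. I \<subseteq> {a}")
  case True
  then obtain a where "I \<subseteq> {a}" ..
  then have "\<forall>s\<in>I. dist (\<xi> s) (\<phi> (\<sigma> s)) = \<bar>(a + dist (\<xi> a) (\<phi> (\<sigma> a))) - s\<bar>"
    by auto
  then show ?thesis ..
next
  case False
  define T where "T = curve_deriv I \<xi>"
  \<comment> \<open>An inner product rather than a choice of the coefficient on each tangent line,
    so that differentiability of \<open>r\<close> comes from that of its factors.\<close>
  define r where "r x = (\<phi> (\<sigma> x) - \<xi> x) \<bullet> T x" for x
  have norm_T: "norm (T s) = 1" and unit_T: "unit_tangent I \<xi> s = T s" if "s \<in> I" for s
    using assms(3) that by (simp_all add: unit_speed_def unit_tangent_def T_def)
  have disp: "\<phi> (\<sigma> s) = \<xi> s + r s *\<^sub>R T s" if s: "s \<in> I" for s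
  proof -
    obtain k where k: "\<phi> (\<sigma> s) = \<xi> s + k *\<^sub>R T s"
      using assms(5) s unit_T[OF s] unfolding corresponding_points_def by metis
    moreover have "r s = k"
      using norm_T[OF s] by (simp add: r_def k norm_eq_1)
    ultimately show ?thesis by simp
  qed
  have \<sigma>: "\<sigma> differentiable_on I" "\<sigma> ` I \<subseteq> I"
    using assms(5) by (simp_all add: corresponding_points_def)
  have deriv: "((\<lambda>x. r x + x) has_derivative (\<lambda>_. 0)) (at s within I)" if s: "s \<in> I" for s
  proof -
    have "\<sigma> s \<in> I"
      using \<sigma>(2) s by blast
    then have "curve_deriv I \<phi> (\<sigma> s) \<noteq> 0"
      using assms(6) by (simp add: involute_evolute_def regular_curve_def)
    moreover have "unit_tangent I \<phi> (\<sigma> s) \<bullet> T s = 0"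
      using assms(6) s unit_T by (simp add: involute_evolute_def quat_inner_eq_0_iff)
    \<comment> \<open>The velocity of \<open>\<phi>\<close> is nonzero, so the scaling by its
      inverse norm can be cancelled.\<close>
    ultimately have orth: "curve_deriv I \<phi> (\<sigma> s) \<bullet> T s = 0"
      by (simp add: unit_tangent_def)
    \<comment> \<open>A connected set with more than one point has no isolated points.\<close>
    have "s islimpt I"
      using connected_imp_perfect[OF is_interval_connected[OF assms(1)] s] False by blast
    then have "at s within I \<noteq> bot"
      by (simp add: trivial_limit_within)
    then have "(r has_vector_derivative -1) (at s within I)"
      unfolding r_def T_def
      using assms(2) has_vector_derivative_tangential_displacement[OF s _ _ assms(3,4) \<sigma>
          disp[OF s, unfolded T_def] orth[unfolded T_def]]
      unfolding regular_curve_def by blast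
    then have "((\<lambda>x. r x + x) has_vector_derivative -1 + 1) (at s within I)"
      by (intro has_vector_derivative_add has_vector_derivative_id)
    then show ?thesis
      by (simp add: has_vector_derivative_def)
  qed
  \<comment> \<open>Convexity of \<open>I\<close> turns the vanishing derivative into one constant
    for the whole interval.\<close>
  obtain c where c: "\<And>s. s \<in> I \<Longrightarrow> r s + s = c"
    using has_derivative_zero_constant[OF is_interval_convex[OF assms(1)] deriv] by blast
  have "dist (\<xi> s) (\<phi> (\<sigma> s)) = \<bar>c - s\<bar>" if s: "s \<in> I" for s
  proof -
    have "dist (\<xi> s) (\<phi> (\<sigma> s)) = \<bar>r s\<bar>"
      unfolding disp[OF s] dist_norm using norm_T[OF s] by simp
    also have "r s = c - s"
      using c[OF s] by simp
    finally show ?thesis .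
  qed
  then show ?thesis by blast
qed

end
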